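(* Let $Z_1:=(L^1[0,+\infty))^{\mathbb{N}}$ be the space of all sequences of (classes of) Lebesgue integrable functions $[0,+\infty)\to\mathbb{R}$, endowed with the product topology coming from the $L^1$-norm topology on each factor. The family of all sequences $(f_n)_n\in Z_1$ such that $(f_n)_n$ converges uniformly to $0$ on $[0,+\infty)$ but does not converge to $0$ in $L^1$-norm is maximal dense-lineable in $Z_1$ and spaceable in $Z_1$.
   Context: Functions equal a.e. are identified, and $\|f\|_1=\int_0^{+\infty}|f(x)|\,dx$. $Z_1$ with coordinatewise operations and the product topology is a separable, metrizable topological vector space. For classes of functions, uniform convergence to $0$ is understood up to null sets, i.e. $\operatorname{ess\,sup}_{[0,+\infty)}|f_n|\to0$. $(f_n)_n$ converges to $0$ in $L^1$-norm if $\|f_n\|_1\to0$. A subset $A$ of a topological vector space $X$ is maximal dense-lineable in $X$ if there is a dense vector subspace $M$ of $X$ with $M\setminus\{0\}\subset A$ and $\dim(M)=\dim(X)$, where $\dim$ is the algebraic (Hamel) dimension. It is spaceable in $X$ if there exists a closed infinite dimensional vector subspace $M$ of $X$ such that $M\setminus\{0\}\subset A$. *)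

theory Defs
  imports
    "HOL-Analysis.Analysis"
    "HOL-Probability.Essential_Supremum"
    "HOL-Library.Function_Algebras"
    "HOL-Library.Equipollence"
begin

section \<open>The space of classes of Lebesgue integrable functions on the half-line\<close>

abbreviation halfline :: "real measure" where
  "halfline \<equiv> lebesgue_on {0..}"

text \<open>
  A partial equivalence relation: its domain consists of the functions that are integrable over
  the half-line. Values at negative arguments are irrelevant, since the space of
  \<^const>\<open>halfline\<close> is \<open>{0..}\<close>.
\<close>

definition L1_rel :: "(real \<Rightarrow> real) \<Rightarrow> (real \<Rightarrow> real) \<Rightarrow> bool" where
  "L1_rel f g \<longleftrightarrow> integrable halfline f \<and> integrable halfline g \<and> (AE x in halfline. f x = g x)"

quotient_type L1 = "real \<Rightarrow> real" / partial: L1_rel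
proof (rule part_equivpI)
  show "\<exists>f. L1_rel f f"
    by (rule exI[of _ "\<lambda>_. 0"]) (simp add: L1_rel_def)
  show "symp L1_rel"
    by (rule sympI) (simp add: L1_rel_def eq_commute)
  show "transp L1_rel"
  proof (rule transpI)
    fix f g h
    assume "L1_rel f g" "L1_rel g h"
    moreover from this have "AE x in halfline. f x = h x"
      unfolding L1_rel_def by (elim conjE) (rule eventually_elim2, auto)
    ultimately show "L1_rel f h"
      unfolding L1_rel_def by blast
  qed
qed

instantiation L1 :: real_vector
begin

lift_definition zero_L1 :: L1 is "\<lambda>_. 0"
  by (simp add: L1_rel_def)

lift_definition plus_L1 :: "L1 \<Rightarrow> L1 \<Rightarrow> L1" is "\<lambda>f g x. f x + g x"
proof -
  fix f f' g g' :: "real \<Rightarrow> real"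
  assume "L1_rel f f'" "L1_rel g g'"
  moreover from this have "AE x in halfline. f x + g x = f' x + g' x"
    unfolding L1_rel_def by (elim conjE) (rule eventually_elim2, auto)
  ultimately show "L1_rel (\<lambda>x. f x + g x) (\<lambda>x. f' x + g' x)"
    unfolding L1_rel_def by simp
qed

lift_definition uminus_L1 :: "L1 \<Rightarrow> L1" is "\<lambda>f x. - f x"
proof -
  fix f g :: "real \<Rightarrow> real"
  assume "L1_rel f g"
  moreover from this have "AE x in halfline. - f x = - g x"
    unfolding L1_rel_def by (elim conjE) (rule eventually_mono, auto)
  ultimately show "L1_rel (\<lambda>x. - f x) (\<lambda>x. - g x)"
    unfolding L1_rel_def by simp
qed

lift_definition minus_L1 :: "L1 \<Rightarrow> L1 \<Rightarrow> L1" is "\<lambda>f g x. f x - g x"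
proof -
  fix f f' g g' :: "real \<Rightarrow> real"
  assume "L1_rel f f'" "L1_rel g g'"
  moreover from this have "AE x in halfline. f x - g x = f' x - g' x"
    unfolding L1_rel_def by (elim conjE) (rule eventually_elim2, auto)
  ultimately show "L1_rel (\<lambda>x. f x - g x) (\<lambda>x. f' x - g' x)"
    unfolding L1_rel_def by simp
qed

lift_definition scaleR_L1 :: "real \<Rightarrow> L1 \<Rightarrow> L1" is "\<lambda>c f x. c * f x"
proof -
  fix c :: real and f g :: "real \<Rightarrow> real"
  assume "L1_rel f g"
  moreover from this have "AE x in halfline. c * f x = c * g x"
    unfolding L1_rel_def by (elim conjE) (rule eventually_mono, auto)
  ultimately show "L1_rel (\<lambda>x. c * f x) (\<lambda>x. c * g x)"
    unfolding L1_rel_def by simp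
qed

instance
proof
  fix f g h :: L1 and a b :: real
  show "f + g + h = f + (g + h)" by transfer (auto simp: L1_rel_def algebra_simps)
  show "f + g = g + f" by transfer (auto simp: L1_rel_def algebra_simps)
  show "0 + f = f" by transfer (auto simp: L1_rel_def)
  show "- f + f = 0" by transfer (auto simp: L1_rel_def)
  show "f - g = f + - g" by transfer (auto simp: L1_rel_def)
  show "a *\<^sub>R (f + g) = a *\<^sub>R f + a *\<^sub>R g"
    by transfer (auto simp: L1_rel_def algebra_simps)
  show "(a + b) *\<^sub>R f = a *\<^sub>R f + b *\<^sub>R f"
    by transfer (auto simp: L1_rel_def algebra_simps)
  show "a *\<^sub>R b *\<^sub>R f = (a * b) *\<^sub>R f"
    by transfer (auto simp: L1_rel_def algebra_simps)
  show "1 *\<^sub>R f = f" by transfer (auto simp: L1_rel_def)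
qed

end

instantiation L1 :: real_normed_vector
begin

lift_definition norm_L1 :: "L1 \<Rightarrow> real" is "\<lambda>f. LINT x|halfline. \<bar>f x\<bar>"
proof -
  fix f g :: "real \<Rightarrow> real"
  assume "L1_rel f g"
  then have int: "integrable halfline f" "integrable halfline g"
    and ae: "AE x in halfline. f x = g x"
    by (simp_all add: L1_rel_def)
  from ae have "AE x in halfline. \<bar>f x\<bar> = \<bar>g x\<bar>"
    by (rule eventually_mono) simp
  with int show "(LINT x|halfline. \<bar>f x\<bar>) = (LINT x|halfline. \<bar>g x\<bar>)"
    by (intro integral_cong_AE) auto
qed

definition sgn_L1 :: "L1 \<Rightarrow> L1" where
  "sgn_L1 f = f /\<^sub>R norm f"

definition dist_L1 :: "L1 \<Rightarrow> L1 \<Rightarrow> real" where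
  "dist_L1 f g = norm (f - g)"

definition uniformity_L1 :: "(L1 \<times> L1) filter" where
  "uniformity_L1 = (INF e\<in>{0<..}. principal {(f, g). dist f g < e})"

definition open_L1 :: "L1 set \<Rightarrow> bool" where
  "open_L1 U \<longleftrightarrow> (\<forall>f\<in>U. eventually (\<lambda>(f', g). f' = f \<longrightarrow> g \<in> U) uniformity)"

instance
proof
  fix f g :: L1 and a :: real and U :: "L1 set"
  show "sgn f = f /\<^sub>R norm f" by (rule sgn_L1_def)
  show "dist f g = norm (f - g)" by (rule dist_L1_def)
  show "uniformity = (INF e\<in>{0<..}. principal {(f, g :: L1). dist f g < e})"
    by (rule uniformity_L1_def)
  show "open U \<longleftrightarrow> (\<forall>f\<in>U. eventually (\<lambda>(f', g). f' = f \<longrightarrow> g \<in> U) uniformity)"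
    by (rule open_L1_def)
  show "norm f = 0 \<longleftrightarrow> f = 0"
  proof transfer
    fix f :: "real \<Rightarrow> real"
    assume "L1_rel f f"
    then have "integrable halfline f"
      by (simp add: L1_rel_def)
    then show "(LINT x|halfline. \<bar>f x\<bar>) = 0 \<longleftrightarrow> L1_rel f (\<lambda>_. 0)"
      by (subst integral_nonneg_eq_0_iff_AE) (simp_all add: L1_rel_def)
  qed
  show "norm (f + g) \<le> norm f + norm g"
  proof transfer
    fix f g :: "real \<Rightarrow> real"
    assume "L1_rel f f" "L1_rel g g"
    then have int: "integrable halfline f" "integrable halfline g"
      by (auto simp: L1_rel_def)
    then have "(LINT x|halfline. \<bar>f x + g x\<bar>) \<le> (LINT x|halfline. \<bar>f x\<bar> + \<bar>g x\<bar>)"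
      by (intro integral_mono) auto
    also have "\<dots> = (LINT x|halfline. \<bar>f x\<bar>) + (LINT x|halfline. \<bar>g x\<bar>)"
      using int by (intro Bochner_Integration.integral_add) auto
    finally show "(LINT x|halfline. \<bar>f x + g x\<bar>) \<le> \<dots>" .
  qed
  show "norm (a *\<^sub>R f) = \<bar>a\<bar> * norm f"
    by transfer (simp add: abs_mult)
qed

end

text \<open>
  The essential supremum of \<open>\<bar>f\<bar>\<close> takes values in \<^typ>\<open>ereal\<close>, because an integrable function
  need not be essentially bounded.
\<close>

lift_definition ess_sup_abs :: "L1 \<Rightarrow> ereal" is "\<lambda>f. esssup halfline (\<lambda>x. ereal \<bar>f x\<bar>)"
proof -
  fix f g :: "real \<Rightarrow> real"
  assume "L1_rel f g"
  then have meas: "f \<in> borel_measurable halfline" "g \<in> borel_measurable halfline"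
    and ae: "AE x in halfline. f x = g x"
    by (simp_all add: L1_rel_def borel_measurable_integrable)
  from ae have "AE x in halfline. ereal \<bar>f x\<bar> = ereal \<bar>g x\<bar>"
    by (rule eventually_mono) simp
  with meas show "esssup halfline (\<lambda>x. ereal \<bar>f x\<bar>) = esssup halfline (\<lambda>x. ereal \<bar>g x\<bar>)"
    by (intro esssup_AE_cong) simp_all
qed


section \<open>The space of sequences\<close>

text \<open>
  The topology on \<^typ>\<open>nat \<Rightarrow> L1\<close> is the product topology of the library (\<open>open_fun_def\<close>).
\<close>

type_synonym Z1 = "nat \<Rightarrow> L1"

instantiation "fun" :: (type, real_vector) real_vector
begin

definition scaleR_fun :: "real \<Rightarrow> ('a \<Rightarrow> 'b) \<Rightarrow> 'a \<Rightarrow> 'b" where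
  "scaleR_fun c f = (\<lambda>x. c *\<^sub>R f x)"

instance
  by standard (auto simp: scaleR_fun_def fun_eq_iff algebra_simps)

end

lemma scaleR_fun_apply [simp]:
  fixes f :: "'a \<Rightarrow> 'b :: real_vector"
  shows "(c *\<^sub>R f) x = c *\<^sub>R f x"
  by (simp add: scaleR_fun_def)

lemma Z1_continuous_add: "continuous_on UNIV (\<lambda>p :: Z1 \<times> Z1. fst p + snd p)"
proof (rule continuous_on_coordinatewise_then_product)
  fix n
  have "continuous_on UNIV (\<lambda>p :: Z1 \<times> Z1. fst p n + snd p n)"
    by (rule continuous_on_add[OF
          continuous_on_product_then_coordinatewise[OF continuous_on_fst[OF continuous_on_id]]
          continuous_on_product_then_coordinatewise[OF continuous_on_snd[OF continuous_on_id]]])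
  then show "continuous_on UNIV (\<lambda>p :: Z1 \<times> Z1. (fst p + snd p) n)"
    by simp
qed

lemma Z1_continuous_scaleR: "continuous_on UNIV (\<lambda>p :: real \<times> Z1. fst p *\<^sub>R snd p)"
proof (rule continuous_on_coordinatewise_then_product)
  fix n
  have "continuous_on UNIV (\<lambda>p :: real \<times> Z1. fst p *\<^sub>R snd p n)"
    by (rule continuous_on_scaleR[OF continuous_on_fst[OF continuous_on_id]
          continuous_on_product_then_coordinatewise[OF continuous_on_snd[OF continuous_on_id]]])
  then show "continuous_on UNIV (\<lambda>p :: real \<times> Z1. (fst p *\<^sub>R snd p) n)"
    by simp
qed


section \<open>Lineability\<close>

text \<open>
  The ambient space \<open>X\<close> is the whole type. The library's \<^const>\<open>dim\<close> is a natural number (and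
  \<open>0\<close> in infinite dimension), so algebraic dimensions are compared through the cardinalities of
  Hamel bases, which do not depend on the choice of the bases.
\<close>

definition hamel_basis :: "'a::real_vector set \<Rightarrow> 'a set \<Rightarrow> bool" where
  "hamel_basis B M \<longleftrightarrow> independent B \<and> span B = M"

definition same_hamel_dim :: "'a::real_vector set \<Rightarrow> 'b::real_vector set \<Rightarrow> bool" where
  "same_hamel_dim M N \<longleftrightarrow> (\<exists>B C. hamel_basis B M \<and> hamel_basis C N \<and> B \<approx> C)"

definition infinite_dimensional :: "'a::real_vector set \<Rightarrow> bool" where
  "infinite_dimensional M \<longleftrightarrow> (\<exists>B. hamel_basis B M \<and> infinite B)"

definition maximal_dense_lineable :: "'a::{real_vector, topological_space} set \<Rightarrow> bool" where
  "maximal_dense_lineable A \<longleftrightarrow>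
    (\<exists>M. subspace M \<and> closure M = UNIV \<and> M - {0} \<subseteq> A \<and> same_hamel_dim M (UNIV :: 'a set))"

definition spaceable :: "'a::{real_vector, topological_space} set \<Rightarrow> bool" where
  "spaceable A \<longleftrightarrow>
    (\<exists>M. subspace M \<and> closed M \<and> infinite_dimensional M \<and> M - {0} \<subseteq> A)"


section \<open>Two modes of convergence\<close>

definition uniformly_null :: "Z1 \<Rightarrow> bool" where
  "uniformly_null f \<longleftrightarrow> (\<lambda>n. ess_sup_abs (f n)) \<longlonglongrightarrow> 0"

definition L1_null :: "Z1 \<Rightarrow> bool" where
  "L1_null f \<longleftrightarrow> (\<lambda>n. norm (f n)) \<longlonglongrightarrow> 0"

end

theory Submission
  imports Defs
begin

text \<open>
  The function \<open>bump n\<close>, which is \<open>1 / (n + 1)\<close> times the indicator of \<open>{0..n + 1}\<close>, has norm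
  \<open>1\<close> and supremum \<open>1 / (n + 1)\<close>. Hence a sequence that is eventually of the form
  \<open>c n *\<^sub>R bump n\<close> with bounded scalars \<open>c n\<close> converges uniformly to \<open>0\<close>, and it converges to \<open>0\<close>
  in norm only if \<open>c n\<close> tends to \<open>0\<close>.

  Let \<open>past_coeff n d\<close> be a scalar that depends linearly on the entries of \<open>d\<close> before position
  \<open>n\<close>, and put \<open>add_bumps d n = d n + past_coeff n d *\<^sub>R bump n\<close>. Since this operator is lower
  triangular with the identity on the diagonal, it is linear and injective, and a sequence with
  prescribed first entries can be reached from one that vanishes after those entries. The
  coefficients are the integrals of single entries of \<open>d\<close> over segments \<open>{0..q}\<close> with rational
  \<open>q\<close>, each pair of an entry and a segment being used at infinitely many positions. Such integrals
  are bounded by the norm of the entry and determine it (\<open>eq_0_if_rational_partial_integrals_0\<close>).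
  Therefore, if \<open>d\<close> is finitely supported and nonzero, then the coefficients are bounded but
  infinitely often equal to a fixed nonzero number, so \<open>add_bumps d\<close> converges uniformly but not in
  norm (\<open>uniformly_null_add_bumps\<close>, \<open>not_L1_null_add_bumps\<close>).

  The image of the finitely supported sequences is the dense subspace. The image of the sequences
  supported at position \<open>0\<close> is the closed one: there \<open>d 0\<close> is the first entry of the image and
  all others are continuous functions of it, so this subspace is the graph of a continuous map.

  As for the dimensions, the separating integrals inject the whole sequence space into the sets
  of a countable set, so it has at most the cardinality of the continuum, while the indicators
  of the segments \<open>{0..t}\<close> with \<open>t > 0\<close> are linearly independent. Thus every subspace that contains
  a linear copy of \<^typ>\<open>L1\<close>, as both of these and the whole space do, has a Hamel basis equipollent
  to the reals.
\<close>

section \<open>Integrals over initial segments separate integrable functions\<close>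

lemma borel_subset_sigma_rational_atMost:
  "sets (borel :: real measure) \<subseteq> sigma_sets UNIV (range (\<lambda>q::rat. {..of_rat q}))"
proof -
  let ?G = "range (\<lambda>q::rat. {..of_rat q :: real})"
  interpret sigma_algebra UNIV "sigma_sets UNIV ?G"
    by (rule sigma_algebra_sigma_sets) simp
  have "{..a} \<in> sigma_sets UNIV ?G" for a :: real
  proof -
    have "{..a} = (\<Inter>q\<in>{q. a < of_rat q}. {..of_rat q :: real})"
    proof (intro equalityI subsetI)
      fix x
      assume x: "x \<in> (\<Inter>q\<in>{q. a < of_rat q}. {..of_rat q :: real})"
      show "x \<in> {..a}"
      proof (rule ccontr)
        assume "x \<notin> {..a}"
        then obtain q where "a < of_rat q" "of_rat q < x"
          using of_rat_dense[of a x] by auto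
        with x show False by force
      qed
    qed auto
    also have "\<dots> \<in> sigma_sets UNIV ?G"
    proof (rule countable_INT'')
      show "countable {q. a < real_of_rat q}" by simp
    qed auto
    finally show ?thesis .
  qed
  then have "sigma_sets UNIV (range (\<lambda>a::real. {..a})) \<subseteq> sigma_sets UNIV ?G"
    by (intro sigma_sets_mono) auto
  then show ?thesis
    by (subst borel_eq_atMost) (simp add: sets_measure_of)
qed

text \<open>
  The Borel sets over which \<open>f\<close> integrates to \<open>0\<close> form a Dynkin system; the rational rays, which
  are stable under intersection and generate the Borel sets, belong to it by assumption.
\<close>

lemma AE_zero_if_rational_atMost_integrals_zero:
  fixes f :: "real \<Rightarrow> real"
  assumes f: "integrable lborel f"
    and zero: "\<And>q::rat. (LINT x:{..of_rat q}|lborel. f x) = 0"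
  shows "AE x in lborel. f x = 0"
proof (rule sigma_finite_measure.density_zero[OF sigma_finite_lborel f])
  have int: "set_integrable lborel A f" if "A \<in> sets borel" for A
    using that f unfolding set_integrable_def by (intro integrable_mult_indicator) auto
  let ?G = "range (\<lambda>q::rat. {..of_rat q :: real})"
  have G: "sigma_sets UNIV ?G = sets borel"
    using borel_subset_sigma_rational_atMost
    by (intro equalityI) (auto intro!: sets.sigma_sets_subset[of _ borel, simplified])
  \<comment> \<open>The whole line is no rational ray; it is needed for the closure under complements.\<close>
  have total: "(LINT x|lborel. f x) = 0"
  proof -
    let ?A = "\<lambda>n::nat. {..real n}"
    have U: "(\<Union>n. ?A n) = UNIV"
      using real_arch_simple by auto
    have "(\<lambda>n. LINT x:?A n|lborel. f x) \<longlonglongrightarrow> (LINT x:(\<Union>n. ?A n)|lborel. f x)"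
      by (rule set_integral_cont_up) (auto simp: incseq_def U intro!: int)
    moreover have "(LINT x:?A n|lborel. f x) = 0" for n
      using zero[of "of_nat n"] by simp
    ultimately show ?thesis
      by (simp add: U LIMSEQ_const_iff set_lebesgue_integral_def)
  qed
  fix A :: "real set"
  assume "A \<in> sets lborel"
  then have A: "A \<in> sigma_sets UNIV ?G"
    by (simp add: G)
  have stable: "Int_stable ?G"
  proof (rule Int_stableI_image)
    fix p q :: rat
    have "{..of_rat p} \<inter> {..of_rat q} = {..of_rat (min p q) :: real}"
      by (auto simp: min_def of_rat_less_eq)
    then show "\<exists>r\<in>UNIV. {..of_rat p} \<inter> {..of_rat q} = {..of_rat r :: real}" by blast
  qed
  show "(LINT x:A|lborel. f x) = 0"
  proof (rule sigma_sets_induct_disjoint[where P = "\<lambda>A. (LINT x:A|lborel. f x) = 0", OF stable _ A])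
    show "(LINT x:A|lborel. f x) = 0" if "A \<in> ?G" for A
      using that zero by auto
    show "(LINT x:{}|lborel. f x) = 0"
      by (simp add: set_lebesgue_integral_def)
    show "(LINT x:UNIV - A|lborel. f x) = 0"
      if "A \<in> sigma_sets UNIV ?G" "(LINT x:A|lborel. f x) = 0" for A
    proof -
      have A: "A \<in> sets borel" using that by (simp add: G)
      have "(LINT x:A \<union> (UNIV - A)|lborel. f x)
          = (LINT x:A|lborel. f x) + (LINT x:UNIV - A|lborel. f x)"
        using A by (intro set_integral_Un int) auto
      then show ?thesis
        using that total by (simp add: set_lebesgue_integral_def)
    qed
    show "(LINT x:(\<Union>i. A i)|lborel. f x) = 0"
      if "disjoint_family A" "range A \<subseteq> sigma_sets UNIV ?G" "\<And>i. (LINT x:A i|lborel. f x) = 0"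
      for A :: "nat \<Rightarrow> real set"
    proof -
      have A: "A i \<in> sets borel" for i using that by (auto simp: G)
      have "(LINT x:(\<Union>i. A i)|lborel. f x) = (\<Sum>i. LINT x:A i|lborel. f x)"
        using A that(1)
        by (intro lebesgue_integral_countable_add int) (auto simp: disjoint_family_on_def)
      then show ?thesis
        by (simp add: that)
    qed
  qed auto
qed

lemma segment_in_sets_halfline: "{0..s} \<in> sets halfline"
  by (auto simp: sets_restrict_space image_iff intro: bexI[of _ "{0..s}"])

lemma set_integrable_segment:
  fixes f :: "real \<Rightarrow> real"
  shows "integrable halfline f \<Longrightarrow> set_integrable halfline {0..s} f"
  unfolding set_integrable_def by (intro integrable_mult_indicator segment_in_sets_halfline)

lift_definition partial_integral :: "real \<Rightarrow> L1 \<Rightarrow> real" is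
  "\<lambda>s f. LINT x:{0..s}|halfline. f x"
proof -
  fix s and f g :: "real \<Rightarrow> real"
  assume "L1_rel f g"
  then have int: "integrable halfline f" "integrable halfline g"
    and ae: "AE x in halfline. f x = g x"
    by (simp_all add: L1_rel_def)
  from int[THEN set_integrable_segment, of s]
  show "(LINT x:{0..s}|halfline. f x) = (LINT x:{0..s}|halfline. g x)"
    unfolding set_lebesgue_integral_def set_integrable_def
    by (intro integral_cong_AE eventually_mono[OF ae]) (auto dest: borel_measurable_integrable)
qed

lemma partial_integral_add: "partial_integral s (f + g) = partial_integral s f + partial_integral s g"
  by transfer (auto simp: L1_rel_def intro!: set_integral_add set_integrable_segment)

lemma partial_integral_scaleR: "partial_integral s (c *\<^sub>R f) = c * partial_integral s f"
  by transfer simp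

lemma abs_partial_integral_le_norm: "\<bar>partial_integral s f\<bar> \<le> norm f"
proof transfer
  fix s and f :: "real \<Rightarrow> real"
  assume "L1_rel f f"
  then have f: "integrable halfline f" by (simp add: L1_rel_def)
  have "\<bar>LINT x:{0..s}|halfline. f x\<bar> \<le> (LINT x|halfline. \<bar>indicator {0..s} x *\<^sub>R f x\<bar>)"
    unfolding set_lebesgue_integral_def by (rule integral_abs_bound)
  also have "\<dots> \<le> (LINT x|halfline. \<bar>f x\<bar>)"
    using f set_integrable_segment[OF f, of s]
    by (intro integral_mono) (auto simp: set_integrable_def indicator_def)
  finally show "\<bar>LINT x:{0..s}|halfline. f x\<bar> \<le> (LINT x|halfline. \<bar>f x\<bar>)" .
qed

lemma bounded_linear_partial_integral: "bounded_linear (partial_integral s)"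
  by (rule bounded_linear_intro[of _ 1])
     (auto simp: partial_integral_add partial_integral_scaleR abs_partial_integral_le_norm)

text \<open>
  Countably many bounded functionals separate the points of \<^typ>\<open>L1\<close>. Passing from the completed
  measure on the half-line to the Borel measure on the line is done by extending \<open>g\<close> by \<open>0\<close> and
  taking a Borel representative.
\<close>

lemma eq_0_if_rational_partial_integrals_0:
  assumes "\<And>q::rat. partial_integral (of_rat q) g = 0"
  shows "g = 0"
  using assms
proof transfer
  fix f :: "real \<Rightarrow> real"
  assume "L1_rel f f" and zero: "\<And>q::rat. (LINT x:{0..of_rat q}|halfline. f x) = 0"
  then have f: "integrable halfline f" by (simp add: L1_rel_def)
  let ?F = "\<lambda>x. indicator {0..} x * f x"
  have F: "integrable lebesgue ?F"
    using f by (simp add: integrable_restrict_space)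
  then obtain F where [measurable]: "F \<in> borel_measurable lborel" and ae: "AE x in lborel. ?F x = F x"
    using completion_ex_borel_measurable_real by blast
  have ae': "AE x in lebesgue. ?F x = F x"
    using ae by (rule AE_completion)
  have "integrable lebesgue F"
    using F ae' by (subst integrable_cong_AE[symmetric, OF _ _ ae']) (auto intro: measurable_completion)
  then have "integrable lborel F"
    by (simp add: integrable_completion)
  moreover have "(LINT x:{..of_rat q}|lborel. F x) = 0" for q
  proof -
    have "(LINT x:{..of_rat q}|lborel. F x) = (LINT x:{..of_rat q}|lebesgue. F x)"
      unfolding set_lebesgue_integral_def by (subst integral_completion) auto
    also have "\<dots> = (LINT x:{..of_rat q}|lebesgue. ?F x)"
      unfolding set_lebesgue_integral_def
      using borel_measurable_integrable[OF F] borel_measurable_integrable[OF \<open>integrable lebesgue F\<close>]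
      by (intro integral_cong_AE eventually_mono[OF ae'] borel_measurable_scaleR
           borel_measurable_indicator) auto
    also have "\<dots> = (LINT x:{0..of_rat q}|halfline. f x)"
      unfolding set_lebesgue_integral_def
      by (subst integral_restrict_space) (auto intro!: Bochner_Integration.integral_cong simp: indicator_def)
    finally show ?thesis by (simp add: zero)
  qed
  ultimately have "AE x in lborel. F x = 0"
    by (rule AE_zero_if_rational_atMost_integrals_zero)
  then have "AE x in lebesgue. F x = 0"
    by (rule AE_completion)
  with ae' have "AE x in lebesgue. x \<in> {0..} \<longrightarrow> f x = 0"
    by eventually_elim (auto simp: indicator_def)
  then have "AE x in halfline. f x = 0"
    by (subst AE_restrict_space_iff) auto
  with f show "L1_rel f (\<lambda>_. 0)"
    by (simp add: L1_rel_def)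
qed

section \<open>Indicators of initial segments\<close>

lift_definition box_fun :: "real \<Rightarrow> L1" is "\<lambda>t. indicator {0..t}"
proof -
  fix t :: real
  have "integrable halfline (indicator {0..t} :: real \<Rightarrow> real)"
    using segment_in_sets_halfline[of t]
    by (intro integrable_real_indicator)
       (auto simp: emeasure_restrict_space emeasure_lborel_Icc_eq)
  then show "L1_rel (indicator {0..t}) (indicator {0..t})"
    by (simp add: L1_rel_def)
qed

lemma partial_integral_box_fun:
  assumes "0 \<le> s" "0 \<le> t"
  shows "partial_integral s (box_fun t) = min s t"
  using assms
proof transfer
  fix s t :: real
  assume "0 \<le> s" "0 \<le> t"
  have "indicator {0..} x *\<^sub>R (indicator {0..s} x *\<^sub>R indicator {0..t} x)
      = (indicator {0..min s t} x :: real)" for x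
    by (auto simp: indicator_def)
  then show "(LINT x:{0..s}|halfline. indicator {0..t} x) = min s t"
    using \<open>0 \<le> s\<close> \<open>0 \<le> t\<close> unfolding set_lebesgue_integral_def
    by (subst integral_restrict_space) simp_all
qed

lemma norm_box_fun: "0 \<le> t \<Longrightarrow> norm (box_fun t) = t"
proof transfer
  fix t :: real
  assume "0 \<le> t"
  have "indicator {0..} x *\<^sub>R \<bar>indicator {0..t} x\<bar> = (indicator {0..t} x :: real)" for x
    by (auto simp: indicator_def)
  then show "(LINT x|halfline. \<bar>indicator {0..t} x :: real\<bar>) = t"
    using \<open>0 \<le> t\<close> by (subst integral_restrict_space) (simp, simp only:, simp)
qed

text \<open>
  This uses that the half-line has positive measure: over a null space, the essential supremum of
  every measurable function is \<open>-\<infinity>\<close>.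
\<close>

lemma ess_sup_abs_nonneg: "0 \<le> ess_sup_abs f"
proof transfer
  fix f :: "real \<Rightarrow> real"
  have "emeasure lebesgue {0..1::real} \<le> emeasure lebesgue {0::real..}"
    by (rule emeasure_mono) auto
  then have "emeasure halfline (space halfline) \<noteq> 0"
    by (auto simp: emeasure_restrict_space)
  then have "0 = esssup halfline (\<lambda>_. 0 :: ereal)"
    by (simp add: esssup_const)
  also have "\<dots> \<le> esssup halfline (\<lambda>x. ereal \<bar>f x\<bar>)"
    by (rule esssup_mono) auto
  finally show "0 \<le> esssup halfline (\<lambda>x. ereal \<bar>f x\<bar>)" .
qed

lemma ess_sup_abs_scaleR_box_fun_le: "ess_sup_abs (c *\<^sub>R box_fun t) \<le> ereal \<bar>c\<bar>"
proof transfer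
  fix c t :: real
  note segment_in_sets_halfline[of t, measurable]
  show "esssup halfline (\<lambda>x. ereal \<bar>c * indicator {0..t} x\<bar>) \<le> ereal \<bar>c\<bar>"
  proof (rule esssup_I)
    show "(\<lambda>x. ereal \<bar>c * indicator {0..t} x\<bar>) \<in> borel_measurable halfline"
      by measurable
  qed (simp add: indicator_def)
qed


section \<open>Hamel bases of cardinality of the continuum\<close>

lemma inj_box_fun: "inj_on box_fun {0<..}"
  using norm_box_fun by (intro inj_onI) (metis greaterThan_iff less_imp_le)

text \<open>
  As a function of \<open>s\<close>, the integral of \<open>box_fun t\<close> over \<open>{0..s}\<close> is \<open>min s t\<close>, which is affine
  except for a kink at \<open>t\<close>. A second difference in \<open>s\<close> around \<open>a\<close>, with a step so small that no
  other kink is met, therefore reads off the coefficient of \<open>box_fun a\<close> from a linear relation.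
\<close>

lemma independent_box_fun: "independent (box_fun ` {0<..})"
proof
  assume "dependent (box_fun ` {0<..})"
  then obtain S u v where S: "finite S" "S \<subseteq> box_fun ` {0<..}" "(\<Sum>v\<in>S. u v *\<^sub>R v) = 0"
    and v: "v \<in> S" "u v \<noteq> 0"
    unfolding dependent_explicit by blast
  obtain T where T: "T \<subseteq> {0<..}" "S = box_fun ` T" and inj: "inj_on box_fun T"
    using S(2) inj_box_fun by (metis inj_on_subset subset_image_iff)
  then have "finite T"
    using S(1) by (simp add: finite_image_iff)
  obtain a where a: "a \<in> T" "v = box_fun a"
    using v T by auto
  \<comment> \<open>Including \<open>0\<close> keeps \<open>a - e\<close> nonnegative, where the formula \<open>min s t\<close> holds.\<close>
  obtain e where e: "0 < e" "\<And>t. t \<in> insert 0 T \<Longrightarrow> t \<noteq> a \<Longrightarrow> e \<le> dist a t"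
    using finite_set_avoid[of "insert 0 T" a] \<open>finite T\<close> by (metis finite_insert)
  have "0 < a" using a T by auto
  with e(2)[of 0] have "e \<le> a" by (simp add: dist_real_def)
  define D where "D g = partial_integral (a + e) g + partial_integral (a - e) g - 2 * partial_integral a g"
    for g
  have lin: "linear D"
    unfolding D_def
    by (rule linearI) (simp_all add: partial_integral_add partial_integral_scaleR algebra_simps)
  have D_box: "D (box_fun t) = (if t = a then - e else 0)" if "t \<in> T" for t
  proof -
    have "0 < t" using T that by auto
    with \<open>0 < a\<close> \<open>0 < e\<close> \<open>e \<le> a\<close>
    have "D (box_fun t) = min (a + e) t + min (a - e) t - 2 * min a t"
      by (simp add: D_def partial_integral_box_fun)
    moreover have "t = a \<or> a + e \<le> t \<or> t \<le> a - e"
      using e(2)[of t] that by (auto simp: dist_real_def)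
    ultimately show ?thesis
      using \<open>0 < e\<close> by (auto simp: min_def)
  qed
  have "0 = D (\<Sum>v\<in>S. u v *\<^sub>R v)"
    using lin S(3) by (simp add: linear_0)
  also have "\<dots> = (\<Sum>t\<in>T. u (box_fun t) * D (box_fun t))"
    using lin inj by (simp add: linear_sum linear_scale T(2) sum.reindex o_def)
  also have "\<dots> = (\<Sum>t\<in>T. if t = a then - e * u (box_fun a) else 0)"
    by (intro sum.cong) (auto simp: D_box)
  also have "\<dots> = - e * u v"
    using \<open>finite T\<close> a by simp
  finally show False
    using \<open>0 < e\<close> v by simp
qed

text \<open>
  A sequence is determined by countably many real numbers, the rational partial integrals of its
  entries, and each of these by the rationals below it.
\<close>

lemma UNIV_Z1_lepoll_reals: "(UNIV :: Z1 set) \<lesssim> (UNIV :: real set)"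
proof -
  let ?F = "\<lambda>(f::Z1) n k. partial_integral (of_rat (from_nat k)) (f n)"
  let ?G = "\<lambda>f. {(n, k, q::rat). of_rat q < ?F f n k}"
  have "inj ?G"
  proof (rule injI)
    fix f g
    assume eq: "?G f = ?G g"
    have F: "?F f n k = ?F g n k" for n k
    proof (rule ccontr)
      assume "?F f n k \<noteq> ?F g n k"
      then obtain q where "?F f n k \<le> of_rat q \<and> of_rat q < ?F g n k
          \<or> ?F g n k \<le> of_rat q \<and> of_rat q < ?F f n k"
        by (metis less_imp_le linorder_neqE_linordered_idom of_rat_dense)
      moreover have "(n, k, q) \<in> ?G f \<longleftrightarrow> (n, k, q) \<in> ?G g"
        using eq by simp
      ultimately show False
        by auto
    qed
    have "f n - g n = 0" for n
    proof (rule eq_0_if_rational_partial_integrals_0)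
      fix q :: rat
      interpret bounded_linear "partial_integral (of_rat q)"
        by (rule bounded_linear_partial_integral)
      show "partial_integral (of_rat q) (f n - g n) = 0"
        using F[where n = n and k = "to_nat q"] by (simp add: diff)
    qed
    then show "f = g"
      by (simp add: fun_eq_iff)
  qed
  then have "(UNIV :: Z1 set) \<lesssim> (UNIV :: (nat \<times> nat \<times> rat) set set)"
    by (auto simp: lepoll_def)
  also have "(UNIV :: (nat \<times> nat \<times> rat) set set) \<lesssim> (UNIV :: nat set set)"
    unfolding lepoll_def
    by (rule exI[of _ "image to_nat"]) (auto simp: inj_image_eq_iff intro!: injI)
  also have "(UNIV :: nat set set) \<approx> (UNIV :: real set)"
    by (rule nat_sets_eqpoll_reals)
  finally show ?thesis .
qed

text \<open>
  A basis that extends the image under \<open>T\<close> of the independent family of segments has at least the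
  cardinality of the continuum, and it has at most the cardinality of the sequence space.
\<close>

lemma hamel_basis_eqpoll_reals:
  fixes T :: "L1 \<Rightarrow> Z1"
  assumes "subspace M" "linear T" "inj T" "range T \<subseteq> M"
  obtains B where "hamel_basis B M" "B \<approx> (UNIV :: real set)"
proof -
  let ?I = "T ` box_fun ` {0<..}"
  have "independent ?I"
    using linear_independent_injective_image[OF assms(2) independent_box_fun
        inj_on_subset[OF assms(3) subset_UNIV]] .
  moreover have "?I \<subseteq> M"
    using assms by auto
  ultimately obtain B where B: "?I \<subseteq> B" "B \<subseteq> M" "independent B" "M \<subseteq> span B"
    using maximal_independent_subset_extend[of ?I M] by metis
  have "inj_on (T \<circ> box_fun) {0<..}"
    by (intro comp_inj_on inj_box_fun inj_on_subset[OF assms(3) subset_UNIV])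
  then have "{0::real<..} \<lesssim> B"
    using B(1) unfolding lepoll_def image_comp by blast
  moreover have "{0::real<..} \<approx> (UNIV :: real set)"
    by (rule eqpoll_real_subset[of 1 2]) auto
  ultimately have "(UNIV :: real set) \<lesssim> B"
    by (meson eqpoll_sym lepoll_trans1)
  moreover have "B \<lesssim> (UNIV :: real set)"
    by (rule lepoll_trans[OF subset_imp_lepoll[OF subset_UNIV] UNIV_Z1_lepoll_reals])
  ultimately have "B \<approx> (UNIV :: real set)"
    by (intro lepoll_antisym)
  moreover have "hamel_basis B M"
    unfolding hamel_basis_def using B(3) span_subspace[OF B(2) B(4) assms(1)] ..
  ultimately show ?thesis
    using that by blast
qed


section \<open>Adding bumps to a finitely supported sequence\<close>

definition bump :: "nat \<Rightarrow> L1" where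
  "bump n = (1 / (real n + 1)) *\<^sub>R box_fun (real n + 1)"

lemma norm_scaleR_bump: "norm (c *\<^sub>R bump n) = \<bar>c\<bar>"
  by (simp add: bump_def norm_box_fun)

lemma ess_sup_abs_scaleR_bump_le: "ess_sup_abs (c *\<^sub>R bump n) \<le> ereal (\<bar>c\<bar> / (real n + 1))"
  using ess_sup_abs_scaleR_box_fun_le[of "c / (real n + 1)" "real n + 1"]
  by (simp add: bump_def)

text \<open>
  The position \<open>n\<close> encodes an entry \<open>m\<close>, a rational number with index \<open>k\<close>, and a counter \<open>i\<close>, whose
  sole purpose is that each pair of \<open>m\<close> and \<open>k\<close> occurs at infinitely many positions. The guard
  \<open>m < n\<close> makes \<open>add_bumps\<close> below lower triangular.
\<close>

definition past_coeff :: "nat \<Rightarrow> Z1 \<Rightarrow> real" where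
  "past_coeff n d = (case prod_decode n of (m, j) \<Rightarrow> case prod_decode j of (k, i) \<Rightarrow>
     if m < n then partial_integral (of_rat (from_nat k)) (d m) else 0)"

lemma past_coeff_add: "past_coeff n (d + d') = past_coeff n d + past_coeff n d'"
  by (simp add: past_coeff_def partial_integral_add split: prod.split)

lemma past_coeff_scaleR: "past_coeff n (c *\<^sub>R d) = c * past_coeff n d"
  by (simp add: past_coeff_def partial_integral_scaleR split: prod.split)

lemma past_coeff_cong: "(\<And>m. m < n \<Longrightarrow> d m = d' m) \<Longrightarrow> past_coeff n d = past_coeff n d'"
  by (simp add: past_coeff_def split: prod.split)

lemma past_coeff_0: "past_coeff 0 d = 0"
  by (simp add: past_coeff_def split: prod.split)

lemma abs_past_coeff_le:
  assumes "\<And>m. norm (d m) \<le> C"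
  shows "\<bar>past_coeff n d\<bar> \<le> C"
proof -
  have "0 \<le> C" using assms[of 0] norm_ge_zero order_trans by blast
  then show ?thesis
    using order_trans[OF abs_partial_integral_le_norm assms]
    by (auto simp: past_coeff_def split: prod.split)
qed

text \<open>
  Some rational partial integral of some entry of \<open>d\<close> is nonzero, and its value recurs at all later
  positions that encode the same entry and the same rational.
\<close>

lemma past_coeff_frequently_nonzero:
  assumes "d \<noteq> 0"
  obtains c where "c \<noteq> 0" "\<And>N. \<exists>n\<ge>N. past_coeff n d = c"
proof -
  obtain m where "d m \<noteq> 0"
    using assms by (auto simp: fun_eq_iff)
  then obtain q :: rat where q: "partial_integral (of_rat q) (d m) \<noteq> 0"
    using eq_0_if_rational_partial_integrals_0 by blast
  show ?thesis
  proof (rule that[OF q])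
    fix N
    define n where "n = prod_encode (m, prod_encode (to_nat q, N + m + 1))"
    have "N + m + 1 \<le> n"
      unfolding n_def using le_prod_encode_2 order_trans by blast
    moreover from this have "past_coeff n d = partial_integral (of_rat q) (d m)"
      by (simp add: past_coeff_def n_def)
    ultimately show "\<exists>n\<ge>N. past_coeff n d = partial_integral (of_rat q) (d m)"
      by (intro exI[of _ n]) auto
  qed
qed

definition add_bumps :: "Z1 \<Rightarrow> Z1" where
  "add_bumps d = (\<lambda>n. d n + past_coeff n d *\<^sub>R bump n)"

lemma linear_add_bumps: "linear add_bumps"
  by (rule linearI)
     (simp_all add: add_bumps_def fun_eq_iff past_coeff_add past_coeff_scaleR algebra_simps)

lemma inj_add_bumps: "inj add_bumps"
proof (rule injI)
  fix d d'
  assume eq: "add_bumps d = add_bumps d'"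
  have "d n = d' n" for n
  proof (induction n rule: less_induct)
    case (less n)
    then have "past_coeff n d = past_coeff n d'"
      by (rule past_coeff_cong)
    with fun_cong[OF eq, of n] show ?case
      by (simp add: add_bumps_def)
  qed
  then show "d = d'" by (simp add: fun_eq_iff)
qed

definition finitely_supported :: "Z1 set" where
  "finitely_supported = {d. \<exists>N. \<forall>n\<ge>N. d n = 0}"

lemma subspace_finitely_supported: "subspace finitely_supported"
proof (rule subspaceI)
  fix d d' assume "d \<in> finitely_supported" "d' \<in> finitely_supported"
  then obtain N N' where "\<forall>n\<ge>N. d n = 0" "\<forall>n\<ge>N'. d' n = 0"
    by (auto simp: finitely_supported_def)
  then show "d + d' \<in> finitely_supported"
    by (auto simp: finitely_supported_def intro!: exI[of _ "max N N'"])
qed (auto simp: finitely_supported_def)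

lemma uniformly_null_add_bumps:
  assumes "d \<in> finitely_supported"
  shows "uniformly_null (add_bumps d)"
proof -
  obtain N where N: "\<And>n. N \<le> n \<Longrightarrow> d n = 0"
    using assms by (auto simp: finitely_supported_def)
  define C where "C = (\<Sum>m<N. norm (d m))"
  have "norm (d m) \<le> C" for m
    using N[of m] member_le_sum[of m "{..<N}" "\<lambda>m. norm (d m)"]
    by (cases "m < N") (auto simp: C_def sum_nonneg)
  then have coeff: "\<bar>past_coeff n d\<bar> \<le> C" for n
    by (rule abs_past_coeff_le)
  have "ess_sup_abs (add_bumps d n) \<le> ereal (C / (real n + 1))" if "N \<le> n" for n
  proof -
    have "ess_sup_abs (add_bumps d n) \<le> ereal (\<bar>past_coeff n d\<bar> / (real n + 1))"
      using N[OF that] ess_sup_abs_scaleR_bump_le by (simp add: add_bumps_def)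
    also have "\<dots> \<le> ereal (C / (real n + 1))"
      using coeff by (simp add: divide_right_mono)
    finally show ?thesis .
  qed
  then have "\<forall>\<^sub>F n in sequentially. ess_sup_abs (add_bumps d n) \<le> ereal (C / (real n + 1))"
    by (auto simp: eventually_sequentially)
  moreover have "(\<lambda>n. C / (real n + 1)) \<longlonglongrightarrow> 0"
    using LIMSEQ_Suc[OF lim_const_over_n[of C]] by (simp add: add.commute)
  then have "(\<lambda>n. ereal (C / (real n + 1))) \<longlonglongrightarrow> 0"
    by (simp add: zero_ereal_def)
  ultimately show ?thesis
    unfolding uniformly_null_def
    by (intro tendsto_sandwich[OF always_eventually[OF allI[OF ess_sup_abs_nonneg]] _ tendsto_const])
qed

lemma not_L1_null_add_bumps:
  assumes "d \<in> finitely_supported" "d \<noteq> 0"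
  shows "\<not> L1_null (add_bumps d)"
proof
  assume "L1_null (add_bumps d)"
  obtain N where N: "\<And>n. N \<le> n \<Longrightarrow> d n = 0"
    using assms(1) by (auto simp: finitely_supported_def)
  obtain c where c: "c \<noteq> 0" "\<And>N. \<exists>n\<ge>N. past_coeff n d = c"
    using past_coeff_frequently_nonzero[OF assms(2)] by blast
  have "\<forall>\<^sub>F n in sequentially. norm (add_bumps d n) < \<bar>c\<bar>"
    using \<open>L1_null (add_bumps d)\<close> c(1) unfolding L1_null_def by (intro order_tendstoD(2)) auto
  then obtain N' where N': "\<And>n. N' \<le> n \<Longrightarrow> norm (add_bumps d n) < \<bar>c\<bar>"
    by (auto simp: eventually_sequentially)
  obtain n where "max N N' \<le> n" "past_coeff n d = c"
    using c(2) by blast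
  with N[of n] N'[of n] show False
    by (simp add: add_bumps_def norm_scaleR_bump del: norm_scaleR)
qed

text \<open>
  The triangular system can be solved one entry at a time: changing \<open>d\<close> at position \<open>N\<close> does not
  affect the coefficients at positions up to \<open>N\<close>.
\<close>

lemma add_bumps_finitely_supported_agrees_on_prefix:
  "\<exists>d\<in>finitely_supported. \<forall>n<N. add_bumps d n = f n"
proof -
  have "\<exists>d. (\<forall>n\<ge>N. d n = 0) \<and> (\<forall>n<N. add_bumps d n = f n)"
  proof (induction N)
    case 0
    show ?case by (intro exI[of _ 0]) simp
  next
    case (Suc N)
    then obtain d where d: "\<And>n. N \<le> n \<Longrightarrow> d n = 0" "\<And>n. n < N \<Longrightarrow> add_bumps d n = f n"
      by blast
    let ?d = "d(N := f N - past_coeff N d *\<^sub>R bump N)"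
    have "past_coeff n ?d = past_coeff n d" if "n \<le> N" for n
      using that by (intro past_coeff_cong) auto
    then have "\<forall>n<Suc N. add_bumps ?d n = f n"
      using d(2) by (auto simp: add_bumps_def less_Suc_eq)
    with d(1) show ?case
      by (intro exI[of _ ?d]) (simp del: fun_upd_apply add: fun_upd_other)
  qed
  then show ?thesis by (auto simp: finitely_supported_def)
qed

lemma closure_add_bumps_finitely_supported: "closure (add_bumps ` finitely_supported) = UNIV"
proof -
  have "f \<in> closure (add_bumps ` finitely_supported)" for f
    unfolding closure_iff_nhds_not_empty
  proof (intro allI impI)
    fix A U :: "Z1 set"
    assume "U \<subseteq> A" "open U" "f \<in> U"
    then obtain X where X: "f \<in> Pi\<^sub>E UNIV X" "finite {n. X n \<noteq> UNIV}" "Pi\<^sub>E UNIV X \<subseteq> U"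
      using product_topology_open_contains_basis[of "\<lambda>_. euclidean" UNIV U f]
      by (auto simp: open_fun_def)
    obtain N where N: "\<And>n. X n \<noteq> UNIV \<Longrightarrow> n < N"
      using X(2) finite_nat_set_iff_bounded by auto
    obtain d where d: "d \<in> finitely_supported" "\<And>n. n < N \<Longrightarrow> add_bumps d n = f n"
      using add_bumps_finitely_supported_agrees_on_prefix by blast
    have "add_bumps d n \<in> X n" for n
      using N[of n] d(2)[of n] X(1) by (cases "X n = UNIV") (auto simp: PiE_iff)
    then have "add_bumps d \<in> A"
      using X(3) \<open>U \<subseteq> A\<close> by auto
    with d(1) show "add_bumps ` finitely_supported \<inter> A \<noteq> {}" by blast
  qed
  then show ?thesis by blast
qed

definition at_first :: "L1 \<Rightarrow> Z1" where
  "at_first g = (\<lambda>n. if n = 0 then g else 0)"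

lemma linear_at_first: "linear at_first"
  by (rule linearI) (simp_all add: at_first_def fun_eq_iff)

lemma inj_at_first: "inj at_first"
  by (rule injI) (metis at_first_def)

lemma at_first_finitely_supported: "at_first g \<in> finitely_supported"
  by (auto simp: finitely_supported_def at_first_def intro: exI[of _ 1])

text \<open>
  No bump is added at position \<open>0\<close>, which has no past. So an element of the range shows its preimage
  as its first entry, and the range is described by equations between continuous functions.
\<close>

lemma range_add_bumps_at_first_eq_graph:
  "range (add_bumps \<circ> at_first) = {f. \<forall>n. f n = add_bumps (at_first (f 0)) n}"
proof (intro equalityI subsetI)
  fix f assume "f \<in> range (add_bumps \<circ> at_first)"
  then obtain g where g: "f = add_bumps (at_first g)" by auto
  have "f 0 = g" unfolding g by (simp add: add_bumps_def at_first_def past_coeff_0)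
  then show "f \<in> {f. \<forall>n. f n = add_bumps (at_first (f 0)) n}"
    by (simp flip: g)
next
  fix f assume "f \<in> {f. \<forall>n. f n = add_bumps (at_first (f 0)) n}"
  then have "f = add_bumps (at_first (f 0))" by blast
  then show "f \<in> range (add_bumps \<circ> at_first)"
    by (metis comp_apply rangeI)
qed

lemma continuous_add_bumps_at_first_coordinate:
  "continuous_on UNIV (\<lambda>g. add_bumps (at_first g) n)"
proof -
  have "bounded_linear (\<lambda>g. past_coeff n (at_first g))"
  proof (rule bounded_linear_intro[of _ 1])
    show "norm (past_coeff n (at_first g)) \<le> norm g * 1" for g
      by (simp, rule abs_past_coeff_le) (simp add: at_first_def)
  qed (simp_all add: linear_add[OF linear_at_first] linear_scale[OF linear_at_first]
         past_coeff_add past_coeff_scaleR)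
  then have "continuous_on UNIV (\<lambda>g. past_coeff n (at_first g))"
    by (rule linear_continuous_on)
  then show ?thesis
    unfolding add_bumps_def
    by (intro continuous_intros) (cases "n = 0"; simp add: at_first_def continuous_on_id)
qed

lemma closed_range_add_bumps_at_first: "closed (range (add_bumps \<circ> at_first))"
proof -
  have "continuous_on UNIV (\<lambda>f::Z1. add_bumps (at_first (f 0)) n)" for n
    using continuous_on_compose2[OF continuous_add_bumps_at_first_coordinate
        continuous_on_product_coordinates[of 0]] by simp
  then show ?thesis
    unfolding range_add_bumps_at_first_eq_graph
    by (intro closed_Collect_all closed_Collect_eq continuous_on_product_coordinates)
qed

theorem theorem4p2:
  shows "maximal_dense_lineable {f :: Z1. uniformly_null f \<and> \<not> L1_null f}
    \<and> spaceable {f :: Z1. uniformly_null f \<and> \<not> L1_null f}"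
proof
  let ?A = "{f :: Z1. uniformly_null f \<and> \<not> L1_null f}"
  let ?T = "add_bumps \<circ> at_first"
  let ?M = "add_bumps ` finitely_supported"
  have T: "linear ?T" "inj ?T"
    by (simp_all add: linear_compose linear_at_first linear_add_bumps inj_compose inj_at_first inj_add_bumps)
  have T_M: "range ?T \<subseteq> ?M"
    using at_first_finitely_supported by auto
  have A: "?M - {0} \<subseteq> ?A"
    using uniformly_null_add_bumps not_L1_null_add_bumps linear_0[OF linear_add_bumps] by auto
  have M: "subspace ?M"
    by (intro linear_subspace_image linear_add_bumps subspace_finitely_supported)
  have W: "subspace (range ?T)"
    by (intro linear_subspace_image T subspace_UNIV)

  obtain B where B: "hamel_basis B ?M" "B \<approx> (UNIV :: real set)"
    using hamel_basis_eqpoll_reals[OF M T T_M] .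
  obtain C where C: "hamel_basis C (UNIV :: Z1 set)" "C \<approx> (UNIV :: real set)"
    using hamel_basis_eqpoll_reals[OF subspace_UNIV T subset_UNIV] .
  have "same_hamel_dim ?M (UNIV :: Z1 set)"
    unfolding same_hamel_dim_def using B C eqpoll_trans eqpoll_sym by blast
  with M A show "maximal_dense_lineable ?A"
    unfolding maximal_dense_lineable_def using closure_add_bumps_finitely_supported by blast

  obtain D where D: "hamel_basis D (range ?T)" "D \<approx> (UNIV :: real set)"
    using hamel_basis_eqpoll_reals[OF W T order_refl] .
  have "infinite D"
    using D(2) eqpoll_finite_iff infinite_UNIV_char_0 by blast
  with D(1) have "infinite_dimensional (range ?T)"
    unfolding infinite_dimensional_def by blast
  with W closed_range_add_bumps_at_first A T_M show "spaceable ?A"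
    unfolding spaceable_def by blast
qed

end
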